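(* Let $B\subset\mathbb{R}^3$ be a closed unit ball. If $Z_1,\dots,Z_N$ are $N$ pairwise non-overlapping (infinite, unit) cylinders in $\mathbb{R}^3$, each of which touches $B$, then $N\le 6$.
   Context: A cylinder means a closed solid right circular cylinder of infinite length and radius $1$ in $\mathbb{R}^3$, i.e. the set of all points at distance at most $1$ from some line (its axis). Two cylinders are non-overlapping if their interiors are disjoint. A cylinder touches the unit ball $B$ if it meets $B$ but does not meet the interior of $B$. *)

theory Defs
  imports "HOL-Analysis.Analysis"
begin

definition is_line :: "(real ^ 3) set \<Rightarrow> bool" where
  "is_line L \<longleftrightarrow> affine L \<and> aff_dim L = 1"

definition is_cylinder :: "(real ^ 3) set \<Rightarrow> bool" where
  "is_cylinder Z \<longleftrightarrow> (\<exists>L. is_line L \<and> Z = {x. infdist x L \<le> 1})"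

definition non_overlapping :: "(real ^ 3) set \<Rightarrow> (real ^ 3) set \<Rightarrow> bool" where
  "non_overlapping Z W \<longleftrightarrow> interior Z \<inter> interior W = {}"

definition touches :: "(real ^ 3) set \<Rightarrow> (real ^ 3) set \<Rightarrow> bool" where
  "touches Z B \<longleftrightarrow> Z \<inter> B \<noteq> {} \<and> Z \<inter> interior B = {}"

end

(*
  Delsarte's linear programming method, applied to tangent lines of a sphere.

  After scaling, the axes become lines tangent to the unit sphere with mutual distances at least 1.
  A line with point of contact p and unit direction u determines the orthonormal frame p, u,
  w = p x u.  Summing Legendre polynomials of degree at most 4 over suitably weighted vectors of the
  frames gives a positive definite kernel K on the set of tangent lines, and K(i, j) is a quartic
  polynomial in x = p_i . p_j, y = u_i . u_j, z = w_i . w_j.  It takes the value 1355 on the diagonal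
  and is at most -226 for two lines at distance at least 1.  Hence 0 <= N (1355 - 226 (N - 1)), which
  excludes N = 7.

  If (q0, q1, q2, q3) is the unit quaternion of the relative rotation of two frames, then x, y, z are
  linear in the squares of the q_k, and the distance condition reads
  4 q2^2 q3^2 >= (q0^2 + q2^2) (q1^2 + q3^2).  The bound on K is therefore an inequality for a quartic
  form on a part of a simplex.
*)
theory Submission
  imports Defs
begin

section \<open>Zonal kernels\<close>

text \<open>The kernels below are the Legendre polynomials of \<open>x \<bullet> y\<close>, made homogeneous in \<open>x\<close> and in \<open>y\<close> so that they
  can be evaluated at vectors of any length; the expansions are the addition theorem for spherical
  harmonics.\<close>

definition zonal2 :: "real^3 \<Rightarrow> real^3 \<Rightarrow> real" where
  "zonal2 x y = (3 * (x \<bullet> y)^2 - (x \<bullet> x) * (y \<bullet> y)) / 2"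

definition zonal3 :: "real^3 \<Rightarrow> real^3 \<Rightarrow> real" where
  "zonal3 x y = (5 * (x \<bullet> y)^3 - 3 * (x \<bullet> y) * (x \<bullet> x) * (y \<bullet> y)) / 2"

definition zonal4 :: "real^3 \<Rightarrow> real^3 \<Rightarrow> real" where
  "zonal4 x y = (35 * (x \<bullet> y)^4 - 30 * (x \<bullet> y)^2 * (x \<bullet> x) * (y \<bullet> y) + 3 * (x \<bullet> x)^2 * (y \<bullet> y)^2) / 8"

definition expansion :: "(real \<times> ('a \<Rightarrow> real)) list \<Rightarrow> 'a \<Rightarrow> 'a \<Rightarrow> real" where
  "expansion L x y = (\<Sum>(c, Y)\<leftarrow>L. c * Y x * Y y)"

lemma inner_eq_expansion:
  "x \<bullet> y = expansion [(1, \<lambda>v. v$1), (1, \<lambda>v. v$2), (1, \<lambda>v. v$3)] x y" for x y :: "real^3"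
  by (simp add: expansion_def inner_vec_def sum_3)

lemma zonal2_eq_expansion:
  "zonal2 x y = expansion
    [(1/4, \<lambda>v. 2 * (v$3)^2 - (v$1)^2 - (v$2)^2),
     (3, \<lambda>v. v$1 * v$3), (3, \<lambda>v. v$2 * v$3),
     (3/4, \<lambda>v. (v$1)^2 - (v$2)^2), (3, \<lambda>v. v$1 * v$2)] x y"
  unfolding zonal2_def expansion_def inner_vec_def sum_3
  by (simp add: field_simps) algebra

lemma zonal3_eq_expansion:
  "zonal3 x y = expansion
    [(1/4, \<lambda>v. v$3 * (2 * (v$3)^2 - 3 * (v$1)^2 - 3 * (v$2)^2)),
     (3/8, \<lambda>v. v$1 * (4 * (v$3)^2 - (v$1)^2 - (v$2)^2)),
     (3/8, \<lambda>v. v$2 * (4 * (v$3)^2 - (v$1)^2 - (v$2)^2)),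
     (15/4, \<lambda>v. v$3 * ((v$1)^2 - (v$2)^2)), (15, \<lambda>v. v$1 * v$2 * v$3),
     (5/8, \<lambda>v. v$1 * ((v$1)^2 - 3 * (v$2)^2)),
     (5/8, \<lambda>v. v$2 * (3 * (v$1)^2 - (v$2)^2))] x y"
  unfolding zonal3_def expansion_def inner_vec_def sum_3
  by (simp add: field_simps) algebra

lemma zonal4_eq_expansion:
  "zonal4 x y = expansion
    [(1/64, \<lambda>v. 35 * (v$3)^4 - 30 * (v$3)^2 * ((v$1)^2 + (v$2)^2 + (v$3)^2)
        + 3 * ((v$1)^2 + (v$2)^2 + (v$3)^2)^2),
     (5/8, \<lambda>v. v$1 * v$3 * (4 * (v$3)^2 - 3 * (v$1)^2 - 3 * (v$2)^2)),
     (5/8, \<lambda>v. v$2 * v$3 * (4 * (v$3)^2 - 3 * (v$1)^2 - 3 * (v$2)^2)),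
     (5/16, \<lambda>v. ((v$1)^2 - (v$2)^2) * (6 * (v$3)^2 - (v$1)^2 - (v$2)^2)),
     (5/4, \<lambda>v. v$1 * v$2 * (6 * (v$3)^2 - (v$1)^2 - (v$2)^2)),
     (35/8, \<lambda>v. v$1 * v$3 * ((v$1)^2 - 3 * (v$2)^2)),
     (35/8, \<lambda>v. v$2 * v$3 * (3 * (v$1)^2 - (v$2)^2)),
     (35/64, \<lambda>v. (v$1)^4 - 6 * (v$1)^2 * (v$2)^2 + (v$2)^4),
     (35/4, \<lambda>v. v$1 * v$2 * ((v$1)^2 - (v$2)^2))] x y"
  unfolding zonal4_def expansion_def inner_vec_def sum_3
  by (simp add: field_simps) algebra

text \<open>For one entry \<open>(c, Y)\<close> the sum factors as \<open>c\<close> times the square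
  of the sum over \<open>i\<close> of \<open>f i\<close>, where \<open>f i\<close> collects the
  weighted values of \<open>Y\<close> at all vectors of frame \<open>i\<close>. The list
  \<open>G\<close> lets several vectors of a frame interact in one kernel.\<close>

lemma expansion_sum_nonneg:
  assumes "\<forall>(c, Y)\<in>set L. c \<ge> 0"
  shows "0 \<le> (\<Sum>i\<in>I. \<Sum>j\<in>I. \<Sum>(a, g)\<leftarrow>G. \<Sum>(b, h)\<leftarrow>G. a * b * expansion L (g i) (h j))"
  using assms
proof (induction L)
  case Nil
  then show ?case by (simp add: expansion_def case_prod_unfold)
next
  case (Cons cY L)
  obtain c Y where cY: "cY = (c, Y)" by fastforce
  define f where "f i = (\<Sum>(a, g)\<leftarrow>G. a * Y (g i))" for i
  have "(\<Sum>(a, g)\<leftarrow>G. \<Sum>(b, h)\<leftarrow>G. a * b * expansion (cY # L) (g i) (h j))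
      = c * f i * f j + (\<Sum>(a, g)\<leftarrow>G. \<Sum>(b, h)\<leftarrow>G. a * b * expansion L (g i) (h j))" for i j
    unfolding cY f_def expansion_def case_prod_unfold
    by (simp add: distrib_left sum_list_addf mult_ac flip: sum_list_const_mult)
  moreover have "(\<Sum>i\<in>I. \<Sum>j\<in>I. c * f i * f j) = c * (\<Sum>i\<in>I. f i)^2"
    unfolding power2_eq_square sum_product by (simp add: sum_distrib_left mult.assoc)
  moreover have "0 \<le> c * (\<Sum>i\<in>I. f i)^2"
    using Cons.prems cY by simp
  ultimately show ?case
    using Cons by (simp add: sum.distrib)
qed

lemma zonal_sum_nonneg:
  fixes G :: "(real \<times> ('i \<Rightarrow> real^3)) list"
  shows "0 \<le> (\<Sum>i\<in>I. \<Sum>j\<in>I. \<Sum>(a, g)\<leftarrow>G. \<Sum>(b, h)\<leftarrow>G. a * b * (g i \<bullet> h j))"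
    and "0 \<le> (\<Sum>i\<in>I. \<Sum>j\<in>I. \<Sum>(a, g)\<leftarrow>G. \<Sum>(b, h)\<leftarrow>G. a * b * zonal2 (g i) (h j))"
    and "0 \<le> (\<Sum>i\<in>I. \<Sum>j\<in>I. \<Sum>(a, g)\<leftarrow>G. \<Sum>(b, h)\<leftarrow>G. a * b * zonal3 (g i) (h j))"
    and "0 \<le> (\<Sum>i\<in>I. \<Sum>j\<in>I. \<Sum>(a, g)\<leftarrow>G. \<Sum>(b, h)\<leftarrow>G. a * b * zonal4 (g i) (h j))"
  unfolding inner_eq_expansion zonal2_eq_expansion zonal3_eq_expansion zonal4_eq_expansion
  by (rule expansion_sum_nonneg, simp)+

section \<open>Pairs of orthonormal frames\<close>

text \<open>Both sides are the Gram determinant of \<open>p\<close>, \<open>u\<close>,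
  \<open>x\<close>. For an orthonormal pair this becomes Parseval's identity in the frame
  \<open>p\<close>, \<open>u\<close>, \<open>cross3 p u\<close>.\<close>

lemma gram_cross3:
  "(cross3 p u \<bullet> x)^2 = (p \<bullet> p) * (u \<bullet> u) * (x \<bullet> x) + 2 * (p \<bullet> u) * (u \<bullet> x) * (p \<bullet> x)
    - (p \<bullet> p) * (u \<bullet> x)^2 - (u \<bullet> u) * (p \<bullet> x)^2 - (x \<bullet> x) * (p \<bullet> u)^2" for p u x :: "real^3"
  unfolding cross3_def inner_vec_def sum_3 by (simp add: vector_def) algebra

lemma cross3_cross3_left: "cross3 (cross3 p u) p = (p \<bullet> p) *\<^sub>R u - (p \<bullet> u) *\<^sub>R p" for p u :: "real^3"
  by (simp add: cross3_simps forall_3)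

lemma cross3_cross3_right: "cross3 u (cross3 p u) = (u \<bullet> u) *\<^sub>R p - (p \<bullet> u) *\<^sub>R u" for p u :: "real^3"
  by (simp add: cross3_simps forall_3)

definition orthonormal_pair :: "real^3 \<Rightarrow> real^3 \<Rightarrow> bool" where
  "orthonormal_pair p u \<longleftrightarrow> p \<bullet> p = 1 \<and> u \<bullet> u = 1 \<and> p \<bullet> u = 0"

lemma orthonormal_pair_cross3:
  assumes "orthonormal_pair p u"
  shows "cross3 p u \<bullet> cross3 p u = 1" "p \<bullet> cross3 p u = 0" "u \<bullet> cross3 p u = 0"
    "cross3 (cross3 p u) p = u" "cross3 u (cross3 p u) = p"
    "(p \<bullet> x)^2 + (u \<bullet> x)^2 + (cross3 p u \<bullet> x)^2 = x \<bullet> x"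
  using assms
  by (simp_all add: orthonormal_pair_def dot_cross dot_cross_self inner_commute[of u p] gram_cross3
      cross3_cross3_left cross3_cross3_right)

text \<open>The mutual inner products of two frames form a rotation matrix with diagonal
  \<open>x\<close>, \<open>y\<close>, \<open>z\<close>. Its rows and columns have norm 1, which
  gives the sums of squares; each diagonal entry equals its own cofactor, which gives the
  products.\<close>

lemma off_diagonal:
  fixes p u p' u' :: "real^3"
  defines "w \<equiv> cross3 p u" and "w' \<equiv> cross3 p' u'"
  defines "x \<equiv> p \<bullet> p'" and "y \<equiv> u \<bullet> u'" and "z \<equiv> w \<bullet> w'"
  assumes "orthonormal_pair p u" and "orthonormal_pair p' u'"
  shows "(p \<bullet> u')^2 + (u \<bullet> p')^2 = 1 - x^2 - y^2 + z^2" and "(p \<bullet> u') * (u \<bullet> p') = x * y - z"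
    and "(p \<bullet> w')^2 + (w \<bullet> p')^2 = 1 - x^2 - z^2 + y^2" and "(p \<bullet> w') * (w \<bullet> p') = x * z - y"
    and "(u \<bullet> w')^2 + (w \<bullet> u')^2 = 1 - y^2 - z^2 + x^2" and "(u \<bullet> w') * (w \<bullet> u') = y * z - x"
proof -
  note f = orthonormal_pair_cross3[OF assms(6), folded w_def]
  note f' = orthonormal_pair_cross3[OF assms(7), folded w'_def]
  have e: "p' \<bullet> p' = 1" "u' \<bullet> u' = 1" "p \<bullet> p = 1" "u \<bullet> u = 1"
    using assms by (simp_all add: orthonormal_pair_def)
  have rows: "x^2 + (p \<bullet> u')^2 + (p \<bullet> w')^2 = 1" "(u \<bullet> p')^2 + y^2 + (u \<bullet> w')^2 = 1"
    "(w \<bullet> p')^2 + (w \<bullet> u')^2 + z^2 = 1"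
    using f'(6)[of p] f'(6)[of u] f'(6)[of w] e f(1)
    by (simp_all add: inner_commute x_def y_def z_def)
  have cols: "x^2 + (u \<bullet> p')^2 + (w \<bullet> p')^2 = 1" "(p \<bullet> u')^2 + y^2 + (w \<bullet> u')^2 = 1"
    "(p \<bullet> w')^2 + (u \<bullet> w')^2 + z^2 = 1"
    using f(6)[of p'] f(6)[of u'] f(6)[of w'] e f'(1)
    by (simp_all add: x_def y_def z_def)
  show "(p \<bullet> u')^2 + (u \<bullet> p')^2 = 1 - x^2 - y^2 + z^2"
    "(p \<bullet> w')^2 + (w \<bullet> p')^2 = 1 - x^2 - z^2 + y^2"
    "(u \<bullet> w')^2 + (w \<bullet> u')^2 = 1 - y^2 - z^2 + x^2"
    using rows cols by linarith+
  have "z = x * y - (p \<bullet> u') * (u \<bullet> p')"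
    unfolding x_def y_def z_def w_def w'_def by (simp add: dot_cross)
  then show "(p \<bullet> u') * (u \<bullet> p') = x * y - z" by simp
  have "y = cross3 w p \<bullet> cross3 w' p'"
    unfolding y_def using f(4) f'(4) by simp
  then show "(p \<bullet> w') * (w \<bullet> p') = x * z - y"
    unfolding dot_cross x_def z_def by simp
  have "x = cross3 u w \<bullet> cross3 u' w'"
    unfolding x_def using f(5) f'(5) by simp
  then show "(u \<bullet> w') * (w \<bullet> u') = y * z - x"
    unfolding dot_cross y_def z_def by simp
qed

definition pair_poly :: "real \<Rightarrow> real \<Rightarrow> real \<Rightarrow> real" where
  "pair_poly x y z =
     315 * z^4 - 105 * y^4 - 315/2 * x^4 + 315 * x^2 * z^2 + 315 * x^2 * y^2 - 630 * x * y * z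
     + 900 * x * z^2 - 90 * x * y^2 + 100 * x^3 - 540 * y * z
     + 135 * z^2 - 81 * y^2 + 675 * x^2 + 436 * x - 465/2"

text \<open>The weights are rounded from a numerical solution of the semidefinite program that minimises the
  ratio of the diagonal value to the bound for admissible pairs.\<close>

lemma kernel_eq_pair_poly:
  fixes p u p' u' :: "real^3"
  defines "w \<equiv> cross3 p u" and "w' \<equiv> cross3 p' u'"
  assumes "orthonormal_pair p u" and "orthonormal_pair p' u'"
  shows "550 * (p \<bullet> p')
    + 24 * (\<Sum>(a, g)\<leftarrow>[(5, p), (2, u)]. \<Sum>(b, h)\<leftarrow>[(5, p'), (2, u')]. a * b * zonal2 g h)
    + (\<Sum>(a, g)\<leftarrow>[(8, p), (- 3, p + w), (- 3, p - w)].
        \<Sum>(b, h)\<leftarrow>[(8, p'), (- 3, p' + w'), (- 3, p' - w')]. a * b * zonal3 g h)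
    + 12 * (\<Sum>(a, g)\<leftarrow>[(1, u), (- 3, w)]. \<Sum>(b, h)\<leftarrow>[(1, u'), (- 3, w')]. a * b * zonal4 g h)
    = pair_poly (p \<bullet> p') (u \<bullet> u') (w \<bullet> w')"
proof -
  define x y z where "x = p \<bullet> p'" and "y = u \<bullet> u'" and "z = w \<bullet> w'"
  note od = off_diagonal[OF assms(3,4), folded w_def w'_def, folded x_def y_def z_def]
  note f = orthonormal_pair_cross3[OF assms(3), folded w_def]
  note f' = orthonormal_pair_cross3[OF assms(4), folded w'_def]
  have e: "p' \<bullet> p' = 1" "u' \<bullet> u' = 1" "p \<bullet> p = 1" "u \<bullet> u = 1"
    using assms by (simp_all add: orthonormal_pair_def)
  have n: "(p + w) \<bullet> (p + w) = 2" "(p - w) \<bullet> (p - w) = 2"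
    "(p' + w') \<bullet> (p' + w') = 2" "(p' - w') \<bullet> (p' - w') = 2"
    using e f(1,2) f'(1,2)
    by (simp_all add: inner_add_left inner_add_right inner_diff_left inner_diff_right inner_commute)
  \<comment> \<open>In every degree the two frames enter symmetrically, and \<open>w\<close> only up
    to sign. Hence off-diagonal entries survive only through the sums of squares and products from
    \<open>off_diagonal\<close>.\<close>
  have k2: "(\<Sum>(a, g)\<leftarrow>[(5, p), (2, u)]. \<Sum>(b, h)\<leftarrow>[(5, p'), (2, u')]. a * b * zonal2 g h)
    = 15 * z^2 - 9 * y^2 + 45/2 * x^2 - 19/2"
    using od(1) by (simp add: zonal2_def e field_simps flip: x_def y_def z_def)
  have k3: "(\<Sum>(a, g)\<leftarrow>[(8, p), (- 3, p + w), (- 3, p - w)].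
      \<Sum>(b, h)\<leftarrow>[(8, p'), (- 3, p' + w'), (- 3, p' - w')]. a * b * zonal3 g h)
    = 900 * x * z^2 - 90 * x * y^2 + 100 * x^3 - 540 * y * z - 114 * x"
    using od(3,4) by (simp add: zonal3_def e n,
        simp add: inner_add_left inner_add_right inner_diff_left inner_diff_right
          flip: x_def y_def z_def) algebra
  have k4: "(\<Sum>(a, g)\<leftarrow>[(1, u), (- 3, w)]. \<Sum>(b, h)\<leftarrow>[(1, u'), (- 3, w')]. a * b * zonal4 g h)
    = 105/4 * z^4 - 35/4 * y^4 + 105/4 * x^2 * z^2 + 105/4 * x^2 * y^2 - 105/8 * x^4 - 105/2 * x * y * z
      - 75/4 * z^2 + 45/4 * y^2 + 45/4 * x^2 - 3/8"
    using od(5,6) by (simp add: zonal4_def e f(1) f'(1) flip: x_def y_def z_def) algebra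
  show ?thesis
    unfolding k2 k3 k4 pair_poly_def x_def[symmetric] y_def[symmetric] z_def[symmetric]
    by (simp add: field_simps)
qed

section \<open>Separated pairs\<close>

text \<open>With \<open>4 / 3 * q0\<^sup>2 = a\<close>, \<open>4 / 3 * q1\<^sup>2 = b\<close>, \<open>q2\<^sup>2 - q0\<^sup>2 / 3 = p\<close> and \<open>q3\<^sup>2 - q1\<^sup>2 / 3 = q\<close>, the admissible region
  becomes \<open>a, b, p, q \<ge> 0\<close>, \<open>a + b + p + q = 1\<close>, \<open>a * b \<le> 4 * p * q\<close>.  The certificate of positivity is rounded
  from a numerical sum of squares; it is symmetric under exchanging \<open>a\<close> with \<open>b\<close> and \<open>p\<close> with \<open>q\<close>.\<close>

definition certificate_half :: "real \<Rightarrow> real \<Rightarrow> real \<Rightarrow> real \<Rightarrow> real" where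
  "certificate_half a b p q =
     a * p * (106/5 * (- 5*a + 3*b - 2*p + 12*q)^2 + 58/5 * (11*a - 9*b - 3*p)^2)
     + a * q * (51 * (- a - b + p + 2*q)^2 + 32/5 * (4*a - 3*b - p)^2)
     + (359/32*a^4 + 17/8*a^3*b + 843/20*a^3*p + 117/20*a^3*q + 109/32*a^2*b^2
        + 559/20*a^2*b*p + 9/20*a^2*b*q + 1181/10*a^2*p^2 + 166/5*a^2*p*q + 15/2*a^2*q^2
        + 189/5*a*b*p^2 + 51/5*a*b*p*q + 229/5*a*p^3 + 996/5*a*p^2*q
        + 501/5*a*p*q^2 + 37*a*q^3 + 31*p^4 + 104/5*p^3*q + 25*p^2*q^2)"

lemma certificate_half_nonneg:
  "a \<ge> 0 \<Longrightarrow> b \<ge> 0 \<Longrightarrow> p \<ge> 0 \<Longrightarrow> q \<ge> 0 \<Longrightarrow> certificate_half a b p q \<ge> 0"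
  unfolding certificate_half_def by (intro add_nonneg_nonneg mult_nonneg_nonneg) simp_all

text \<open>The right side is a quartic form while \<open>pair_poly\<close> mixes degrees; the
  hypothesis reconciles them, so eliminating \<open>q\<close> leaves a plain polynomial identity.
  The multiplier of the constraint \<open>4*p*q - a*b\<close> is a sum of two squares.\<close>

lemma certificate:
  fixes a b p q :: real
  assumes "a + b + p + q = 1"
  shows "- 226 - pair_poly ((a + b)/2 - p - q) (a - b + p - q) ((a - b)/2 - p + q)
    = certificate_half a b p q + certificate_half b a q p
      + (4*p*q - a*b) * (77/5 * (10*(a + b) - (p + q))^2 + 67/5 * (5*(a - b) - 4*(p - q))^2)"
proof -
  have q: "q = 1 - a - b - p" using assms by simp
  show ?thesis unfolding q pair_poly_def certificate_half_def
    by (simp add: field_simps) algebra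
qed

text \<open>Up to positive factors, the hypotheses say that \<open>a\<close>, \<open>b\<close>,
  \<open>p\<close>, \<open>q\<close> and \<open>4*p*q - a*b\<close> are nonnegative, so every
  summand of \<open>certificate\<close> is nonnegative.\<close>

lemma pair_poly_le:
  fixes x y z :: real
  assumes "0 \<le> 1 + x + y + z" and "0 \<le> 1 + x - y - z"
    and "1 + x + y + z \<le> 3 * (1 - x + y - z)" and "1 + x - y - z \<le> 3 * (1 - x - y + z)"
    and "z^2 + 2 * x \<le> x^2 + 2 * y * z"
  shows "pair_poly x y z \<le> - 226"
proof -
  define a b p q where "a = (1 + x + y + z) / 3" and "b = (1 + x - y - z) / 3"
    and "p = (1 - x + y - z) / 4 - a / 4" and "q = (1 - x - y + z) / 4 - b / 4"
  note abpq = this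
  have nonneg: "a \<ge> 0" "b \<ge> 0" "p \<ge> 0" "q \<ge> 0"
    using assms by (simp_all add: abpq)
  have xyz: "x = (a + b)/2 - p - q" "y = a - b + p - q" "z = (a - b)/2 - p + q"
    and sum1: "a + b + p + q = 1"
    by (simp_all add: abpq field_simps)
  have "4*p*q - a*b = (x^2 + 2 * y * z - z^2 - 2 * x) / 3"
    unfolding abpq by (simp add: field_simps power2_eq_square)
  then have "4*p*q - a*b \<ge> 0"
    using assms by simp
  then have "- 226 - pair_poly x y z \<ge> 0"
    unfolding xyz certificate[OF sum1]
    by (intro add_nonneg_nonneg mult_nonneg_nonneg certificate_half_nonneg nonneg) simp_all
  then show ?thesis by simp
qed

section \<open>From the distance of two lines to the admissible region\<close>

lemma nonneg_if_pairwise_products_nonneg: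
  fixes a b c d :: real
  assumes "0 < a + b + c + d" and "0 \<le> a * b" "0 \<le> a * c" "0 \<le> a * d"
  shows "0 \<le> a"
proof (rule ccontr)
  assume "\<not> 0 \<le> a"
  then have "b \<le> 0" "c \<le> 0" "d \<le> 0"
    using assms(2-4) by (auto simp: zero_le_mult_iff)
  with \<open>\<not> 0 \<le> a\<close> assms(1) show False by simp
qed

lemma pair_poly_le_if_separated:
  fixes p u p' u' :: "real^3"
  assumes op: "orthonormal_pair p u" and op': "orthonormal_pair p' u'"
    and sep: "\<And>s t. 1 \<le> norm (p + s *\<^sub>R u - (p' + t *\<^sub>R u'))"
  shows "pair_poly (p \<bullet> p') (u \<bullet> u') (cross3 p u \<bullet> cross3 p' u') \<le> - 226"
proof -
  define x y z e f where "x = p \<bullet> p'" and "y = u \<bullet> u'" and "z = cross3 p u \<bullet> cross3 p' u'"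
    and "e = u \<bullet> p'" and "f = p \<bullet> u'"
  note od = off_diagonal[OF op op', folded x_def y_def z_def e_def f_def]
  have dist: "1 \<le> 2 - 2 * x + s^2 + t^2 - 2 * s * e - 2 * t * f - 2 * s * t * y" for s t
  proof -
    have "1 \<le> (norm (p + s *\<^sub>R u - (p' + t *\<^sub>R u')))^2"
      using sep[of s t] by simp
    also have "\<dots> = 2 - 2 * x + s^2 + t^2 - 2 * s * e - 2 * t * f - 2 * s * t * y"
      using op op' unfolding power2_norm_eq_inner orthonormal_pair_def
      by (simp add: x_def y_def e_def f_def inner_simps inner_commute[of p' p] inner_commute[of u' p']
          inner_commute[of u p] inner_commute[of u' p] inner_commute[of p' u] inner_commute[of u' u]
          power2_eq_square algebra_simps)
    finally show ?thesis .
  qed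
  \<comment> \<open>\<open>A, B, C, D\<close> are the squared quaternion components \<open>q0\<^sup>2, q1\<^sup>2, q2\<^sup>2, q3\<^sup>2\<close>, multiplied by 4.\<close>
  define A B C D where "A = 1 + x + y + z" and "B = 1 + x - y - z"
    and "C = 1 - x + y - z" and "D = 1 - x - y + z"
  note ABCD = A_def B_def C_def D_def
  \<comment> \<open>Sums and differences of opposite off-diagonal entries of a rotation matrix are,
    up to sign, four times products of two quaternion components. Working with their squares yields
    nonnegativity of \<open>A\<close>, \<open>B\<close>, \<open>C\<close>, \<open>D\<close> without
    constructing the quaternion.\<close>
  have "A * B = (u \<bullet> cross3 p' u' - cross3 p u \<bullet> u')^2" "C * D = (u \<bullet> cross3 p' u' + cross3 p u \<bullet> u')^2"
    "A * C = (p \<bullet> cross3 p' u' - cross3 p u \<bullet> p')^2" "B * D = (p \<bullet> cross3 p' u' + cross3 p u \<bullet> p')^2"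
    "A * D = (f - e)^2" "B * C = (f + e)^2"
    using od unfolding ABCD power2_diff power2_sum by (simp_all add: power2_eq_square algebra_simps)
  then have "0 \<le> A * B" "0 \<le> C * D" "0 \<le> A * C" "0 \<le> B * D" "0 \<le> A * D" "0 \<le> B * C"
    by simp_all
  moreover have "A + B + C + D = 4"
    by (simp add: ABCD)
  ultimately have nonneg: "0 \<le> A" "0 \<le> B" "0 \<le> C" "0 \<le> D"
    using nonneg_if_pairwise_products_nonneg[of A B C D] nonneg_if_pairwise_products_nonneg[of B A C D]
      nonneg_if_pairwise_products_nonneg[of C A B D] nonneg_if_pairwise_products_nonneg[of D A B C]
    by (simp_all add: mult.commute add_ac)
  have "z^2 + 2 * x \<le> x^2 + 2 * y * z \<and> A \<le> 3 * C \<and> B \<le> 3 * D"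
  \<comment> \<open>For parallel lines the common perpendicular is not unique, but the matrix
    degenerates: two of \<open>A\<close>, \<open>B\<close>, \<open>C\<close>, \<open>D\<close>
    vanish, and the distance of the contact points alone suffices.\<close>
  proof (cases "y^2 = 1")
    case True
    have "x \<le> 1/2"
      using dist[of 0 0] by simp
    from True consider "y = 1" | "y = - 1"
      by (auto simp: power2_eq_1_iff)
    then show ?thesis
    proof cases
      case 1
      then have "z = x" using nonneg unfolding ABCD by simp
      with 1 \<open>x \<le> 1/2\<close> show ?thesis by (simp add: ABCD)
    next
      case 2
      then have "z = - x" using nonneg unfolding ABCD by simp
      with 2 \<open>x \<le> 1/2\<close> show ?thesis by (simp add: ABCD)
    qed
  next
    case False
    have AC: "A + C = 2 * (1 + y)" and BD: "B + D = 2 * (1 - y)"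
      by (simp_all add: ABCD)
    then have pos: "0 < A + C" "0 < B + D"
      using nonneg False by (auto simp: power2_eq_1_iff less_le)
    \<comment> \<open>The squared sine of the angle between the lines, and the determinant of the
      form \<open>s^2 + t^2 - 2 * s * t * y\<close>.\<close>
    define E where "E = 1 - y^2"
    have "4 * E = (A + C) * (B + D)"
      unfolding AC BD E_def by (simp add: power2_eq_square algebra_simps)
    with pos have E: "0 < E"
      by (metis mult_pos_pos zero_less_mult_iff zero_less_numeral not_numeral_less_zero)
    \<comment> \<open>The choice of parameters realises the common perpendicular of the two lines.\<close>
    have "1 \<le> 2 - 2 * x - (e^2 + f^2 + 2 * (f * e) * y) / E"
    proof -
      \<comment> \<open>The critical point of the squared distance, solving
        \<open>s - t * y = e\<close> and \<open>t - s * y = f\<close>.\<close>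
      define s t where "s = (e + f * y) / E" and "t = (f + e * y) / E"
      have st: "s - t * y = e" "t - s * y = f"
      proof -
        have "s * E = e + f * y" "t * E = f + e * y"
          using E by (simp_all add: s_def t_def)
        then have "(s - t * y) * E = e * E" "(t - s * y) * E = f * E"
          unfolding E_def by algebra+
        then show "s - t * y = e" "t - s * y = f"
          using E by simp_all
      qed
      have "s * e + t * f = (e^2 + f^2 + 2 * (f * e) * y) / E"
        unfolding s_def t_def by (simp add: power2_eq_square add_divide_distrib algebra_simps)
      moreover have "s^2 + t^2 - 2 * s * t * y = s * e + t * f"
        unfolding st[symmetric] by (simp add: power2_eq_square algebra_simps)
      ultimately show ?thesis
        using dist[of s t] by (simp add: algebra_simps)
    qed
    then have "E \<le> (2 - 2 * x) * E - (e^2 + f^2 + 2 * (f * e) * y)"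
      using E by (simp add: field_simps)
    then have g: "z^2 + 2 * x \<le> x^2 + 2 * y * z"
    proof -
      have "e^2 + f^2 + 2 * (f * e) * y = 1 - x^2 - y^2 + z^2 + 2 * (x * y - z) * y"
        using od(1,2) by simp
      with \<open>E \<le> _\<close> show ?thesis
        unfolding E_def by (simp add: power2_eq_square algebra_simps)
    qed
    have "4 * (C * D) - (A + C) * (B + D) = 4 * (x^2 + 2 * y * z - z^2 - 2 * x)"
      unfolding ABCD by (simp add: power2_eq_square algebra_simps)
    with g have CD: "(A + C) * (B + D) \<le> 4 * (C * D)" by simp
    have "0 < C * D"
      using CD mult_pos_pos[OF pos] by linarith
    then have CD_pos: "0 < C" "0 < D"
      using nonneg by (auto simp: zero_less_mult_iff)
    \<comment> \<open>Dropping \<open>A\<close> or \<open>B\<close> from one factor and cancelling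
      \<open>C\<close> or \<open>D\<close> turns the quadratic condition into the two linear
      ones.\<close>
    have "C * (B + D) \<le> (A + C) * (B + D)" "(A + C) * D \<le> (A + C) * (B + D)"
      using nonneg by (auto intro: mult_right_mono mult_left_mono)
    then have "C * (B + D) \<le> C * (4 * D)" "(A + C) * D \<le> (4 * C) * D"
      using CD by simp_all
    then show ?thesis
      using CD_pos g by simp
  qed
  then show ?thesis
    using pair_poly_le[of x y z] nonneg unfolding ABCD x_def y_def z_def by blast
qed

section \<open>Summing the kernel over all pairs of lines\<close>

lemma pair_poly_sum_nonneg:
  fixes p u :: "'i \<Rightarrow> real^3"
  assumes "\<And>i. i \<in> I \<Longrightarrow> orthonormal_pair (p i) (u i)"
  shows "0 \<le> (\<Sum>i\<in>I. \<Sum>j\<in>I.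
    pair_poly (p i \<bullet> p j) (u i \<bullet> u j) (cross3 (p i) (u i) \<bullet> cross3 (p j) (u j)))"
proof -
  define w where "w i = cross3 (p i) (u i)" for i
  define k1 where "k1 i j = p i \<bullet> p j" for i j
  define k2 where "k2 i j = (\<Sum>(a, g)\<leftarrow>[(5, p i), (2, u i)].
    \<Sum>(b, h)\<leftarrow>[(5, p j), (2, u j)]. a * b * zonal2 g h)" for i j
  define k3 where "k3 i j = (\<Sum>(a, g)\<leftarrow>[(8, p i), (- 3, p i + w i), (- 3, p i - w i)].
    \<Sum>(b, h)\<leftarrow>[(8, p j), (- 3, p j + w j), (- 3, p j - w j)]. a * b * zonal3 g h)" for i j
  define k4 where "k4 i j = (\<Sum>(a, g)\<leftarrow>[(1, u i), (- 3, w i)].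
    \<Sum>(b, h)\<leftarrow>[(1, u j), (- 3, w j)]. a * b * zonal4 g h)" for i j
  have "0 \<le> (\<Sum>i\<in>I. \<Sum>j\<in>I. k1 i j)" "0 \<le> (\<Sum>i\<in>I. \<Sum>j\<in>I. k2 i j)"
    "0 \<le> (\<Sum>i\<in>I. \<Sum>j\<in>I. k3 i j)" "0 \<le> (\<Sum>i\<in>I. \<Sum>j\<in>I. k4 i j)"
    using zonal_sum_nonneg(1)[where I = I and G = "[(1, p)]"] zonal_sum_nonneg(2)[where I = I and G = "[(5, p), (2, u)]"]
      zonal_sum_nonneg(3)[where I = I and G = "[(8, p), (- 3, \<lambda>i. p i + w i), (- 3, \<lambda>i. p i - w i)]"]
      zonal_sum_nonneg(4)[where I = I and G = "[(1, u), (- 3, w)]"]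
    by (simp_all add: k1_def k2_def k3_def k4_def)
  \<comment> \<open>The positive coefficients are those of
    \<open>kernel_eq_pair_poly\<close>.\<close>
  then have "0 \<le> 550 * (\<Sum>i\<in>I. \<Sum>j\<in>I. k1 i j) + 24 * (\<Sum>i\<in>I. \<Sum>j\<in>I. k2 i j)
      + (\<Sum>i\<in>I. \<Sum>j\<in>I. k3 i j) + 12 * (\<Sum>i\<in>I. \<Sum>j\<in>I. k4 i j)"
    by simp
  also have "\<dots> = (\<Sum>i\<in>I. \<Sum>j\<in>I. 550 * k1 i j + 24 * k2 i j + k3 i j + 12 * k4 i j)"
    by (simp add: sum.distrib sum_distrib_left)
  also have "\<dots> = (\<Sum>i\<in>I. \<Sum>j\<in>I. pair_poly (p i \<bullet> p j) (u i \<bullet> u j) (w i \<bullet> w j))"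
    unfolding k1_def k2_def k3_def k4_def w_def
    by (intro sum.cong refl kernel_eq_pair_poly assms)
  finally show ?thesis
    by (simp only: w_def)
qed

lemma card_separated_le_6:
  fixes p u :: "'i \<Rightarrow> real^3"
  assumes "finite I" and op: "\<And>i. i \<in> I \<Longrightarrow> orthonormal_pair (p i) (u i)"
    and sep: "\<And>i j s t. i \<in> I \<Longrightarrow> j \<in> I \<Longrightarrow> i \<noteq> j \<Longrightarrow>
      1 \<le> norm (p i + s *\<^sub>R u i - (p j + t *\<^sub>R u j))"
  shows "card I \<le> 6"
proof -
  define K where "K i j = pair_poly (p i \<bullet> p j) (u i \<bullet> u j) (cross3 (p i) (u i) \<bullet> cross3 (p j) (u j))"
    for i j
  have diag: "K i i = 1355" if "i \<in> I" for i
    using op[OF that] orthonormal_pair_cross3(1)[OF op[OF that]]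
    by (simp add: K_def orthonormal_pair_def pair_poly_def)
  have off: "K i j \<le> - 226" if "i \<in> I" "j \<in> I" "i \<noteq> j" for i j
    unfolding K_def using that by (intro pair_poly_le_if_separated op sep)
  have "0 \<le> (\<Sum>i\<in>I. \<Sum>j\<in>I. K i j)"
    unfolding K_def by (rule pair_poly_sum_nonneg[OF op])
  also have "\<dots> \<le> (\<Sum>i\<in>I. 1355 - 226 * (real (card I) - 1))"
  proof (rule sum_mono)
    fix i assume i: "i \<in> I"
    have "(\<Sum>j\<in>I. K i j) = K i i + (\<Sum>j\<in>I - {i}. K i j)"
      using assms(1) i by (rule sum.remove)
    also have "\<dots> \<le> 1355 + (\<Sum>j\<in>I - {i}. - 226)"
      using diag[OF i] i by (intro add_mono sum_mono off) auto
    also have "\<dots> = 1355 - 226 * (real (card I) - 1)"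
      using assms(1) i card_gt_0_iff[of I] by (auto simp: of_nat_diff Suc_le_eq)
    finally show "(\<Sum>j\<in>I. K i j) \<le> 1355 - 226 * (real (card I) - 1)" .
  qed
  \<comment> \<open>The margin is a single unit: 7 * 226 = 1582.\<close>
  finally have "0 \<le> real (card I) * (1581 - 226 * real (card I))"
    by (simp add: algebra_simps)
  then show ?thesis
    by (auto simp: zero_le_mult_iff)
qed

section \<open>Touching cylinders\<close>

text \<open>A nearest point \<open>y\<close> exists since the line is closed. If
  \<open>k = (y - c) \<bullet> v\<close> were nonzero, moving from \<open>y\<close> by
  \<open>- k\<close> along \<open>v\<close> would lower the squared distance by
  \<open>k^2\<close>.\<close>

lemma line_foot_point:
  assumes "is_line L"
  obtains y v where "v \<bullet> v = 1" and "y \<in> L" and "\<And>t. y + t *\<^sub>R v \<in> L"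
    "infdist c L = dist c y" and "(y - c) \<bullet> v = 0"
proof -
  have aff: "affine L" and dim: "aff_dim L = 1"
    using assms by (auto simp: is_line_def)
  have ne: "L \<noteq> {}"
    using dim by auto
  have cl: "closed L"
    using aff by (rule affine_closed)
  obtain y where y: "y \<in> L" "infdist c L = dist c y"
    using infdist_attains_inf[OF cl ne] by metis
  have "L \<noteq> {y}"
    using dim by auto
  then obtain z where z: "z \<in> L" "z \<noteq> y"
    using y(1) by blast
  define v where "v = (1 / norm (z - y)) *\<^sub>R (z - y)"
  have v: "v \<bullet> v = 1"
    using z by (simp add: v_def dot_square_norm power2_eq_square)
  have on: "y + t *\<^sub>R v \<in> L" for t
  proof -
    have "y + t *\<^sub>R v = (1 - t / norm (z - y)) *\<^sub>R y + (t / norm (z - y)) *\<^sub>R z"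
      by (simp add: v_def algebra_simps)
    then show ?thesis
      using aff y(1) z(1) by (simp add: affine_alt mem_affine)
  qed
  have "(y - c) \<bullet> v = 0"
  proof -
    define k where "k = (y - c) \<bullet> v"
    have "dist c y \<le> dist c (y + (- k) *\<^sub>R v)"
      using infdist_le[OF on[of "- k"], of c] y(2) by simp
    also have "\<dots> = norm (y - c - k *\<^sub>R v)"
      unfolding dist_commute[of c] by (simp add: dist_norm algebra_simps)
    finally have "(norm (y - c))^2 \<le> (norm (y - c - k *\<^sub>R v))^2"
      by (simp add: dist_norm norm_minus_commute)
    then have "(y - c) \<bullet> (y - c) \<le> (y - c - k *\<^sub>R v) \<bullet> (y - c - k *\<^sub>R v)"
      by (simp only: power2_norm_eq_inner)
    also have "\<dots> = (y - c) \<bullet> (y - c) - k^2"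
    proof -
      have "(d - k *\<^sub>R v) \<bullet> (d - k *\<^sub>R v) = d \<bullet> d - k^2" if "d \<bullet> v = k" for d
        using that v by (simp add: inner_diff_left inner_diff_right inner_commute[of v d] power2_eq_square)
      then show ?thesis by (simp add: k_def)
    qed
    finally show ?thesis by (simp add: k_def)
  qed
  with that v y on show thesis by blast
qed

text \<open>The triangle inequality bounds the distance above. If it were below 2, the midpoint of
  \<open>c\<close> and its foot point would lie in the cylinder and inside the open ball.\<close>

lemma infdist_axis_eq_2:
  fixes c :: "real^3"
  assumes "is_line L" and "touches {x. infdist x L \<le> 1} (cball c 1)"
  shows "infdist c L = 2"
proof (rule antisym)
  obtain x where x: "infdist x L \<le> 1" "dist c x \<le> 1"
    using assms(2) by (auto simp: touches_def)
  have "infdist c L \<le> infdist x L + dist c x"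
    by (rule infdist_triangle)
  with x show "infdist c L \<le> 2" by simp
next
  show "2 \<le> infdist c L"
  proof (rule ccontr)
    assume "\<not> 2 \<le> infdist c L"
    obtain y where y: "y \<in> L" "infdist c L = dist c y"
      using line_foot_point[OF assms(1)] by metis
    let ?m = "midpoint c y"
    have "dist ?m y < 1" "dist c ?m < 1"
      using y \<open>\<not> 2 \<le> infdist c L\<close> by (simp_all add: dist_midpoint)
    then have "?m \<in> {x. infdist x L \<le> 1} \<inter> interior (cball c 1)"
      using infdist_le[OF y(1), of ?m] by simp
    then show False
      using assms(2) by (auto simp: touches_def)
  qed
qed

text \<open>Otherwise the midpoint of \<open>x\<close> and \<open>y\<close> would be at distance
  less than 1 from both axes, hence interior to both cylinders.\<close>

lemma dist_axes_ge_2: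
  assumes "non_overlapping {x. infdist x L \<le> 1} {x. infdist x M \<le> 1}" and "x \<in> L" and "y \<in> M"
  shows "2 \<le> dist x y"
proof (rule ccontr)
  assume "\<not> 2 \<le> dist x y"
  have int: "midpoint x y \<in> interior {z. infdist z K \<le> 1}" if "k \<in> K" "dist (midpoint x y) k < 1" for k K
  proof (rule interiorI)
    show "open {z. infdist z K < 1}"
      by (intro open_Collect_less continuous_intros)
    show "midpoint x y \<in> {z. infdist z K < 1}"
      using infdist_le[OF that(1), of "midpoint x y"] that(2) by simp
  qed auto
  have "dist (midpoint x y) x < 1" "dist (midpoint x y) y < 1"
    using \<open>\<not> 2 \<le> dist x y\<close> by (simp_all add: dist_midpoint)
  then show False
    using int[of x L] int[of y M] assms by (auto simp: non_overlapping_def)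
qed


text \<open>The foot point of \<open>c\<close> on the axis is \<open>c + 2 *\<^sub>R p\<close>; the
  factor 2 rescales the sphere of radius 2 touched by the axes to the unit sphere.\<close>

lemma touching_cylinder_frame:
  assumes "is_cylinder Z" and "touches Z (cball c 1)"
  obtains p u L where "orthonormal_pair p u" and "Z = {x. infdist x L \<le> 1}"
    and "\<And>t. c + 2 *\<^sub>R p + t *\<^sub>R u \<in> L"
proof -
  obtain L where L: "is_line L" "Z = {x. infdist x L \<le> 1}"
    using assms(1) by (auto simp: is_cylinder_def)
  obtain y v where v: "v \<bullet> v = 1" "\<And>t. y + t *\<^sub>R v \<in> L"
    and y: "infdist c L = dist c y" "(y - c) \<bullet> v = 0"
    using line_foot_point[OF L(1), of c] by metis
  define p where "p = (1/2) *\<^sub>R (y - c)"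
  have "norm (y - c) = 2"
    using infdist_axis_eq_2[of L c] L assms(2) y(1) by (simp add: dist_norm norm_minus_commute)
  then have "orthonormal_pair p v"
    using v(1) y(2) by (simp add: orthonormal_pair_def p_def dot_square_norm)
  moreover have "c + 2 *\<^sub>R p + t *\<^sub>R v \<in> L" for t
    using v(2)[of t] by (simp add: p_def)
  ultimately show thesis
    using that L(2) by blast
qed

theorem theorem1p1:
  fixes c :: "real ^ 3" and B :: "(real ^ 3) set" and N :: nat and Z :: "nat \<Rightarrow> (real ^ 3) set"
  assumes "B = cball c 1"
    and "\<And>i. i \<in> {1..N} \<Longrightarrow> is_cylinder (Z i)"
    and "\<And>i j. i \<in> {1..N} \<Longrightarrow> j \<in> {1..N} \<Longrightarrow> i \<noteq> j \<Longrightarrow> non_overlapping (Z i) (Z j)"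
    and "\<And>i. i \<in> {1..N} \<Longrightarrow> touches (Z i) B"
  shows "N \<le> 6"
proof -
  define I where "I = {1..N}"
  have "\<exists>p u. \<forall>i\<in>I. orthonormal_pair (p i) (u i) \<and>
      (\<exists>L. Z i = {x. infdist x L \<le> 1} \<and> (\<forall>t. c + 2 *\<^sub>R p i + t *\<^sub>R u i \<in> L))"
  proof -
    have "\<exists>p u L. orthonormal_pair p u \<and> Z i = {x. infdist x L \<le> 1} \<and> (\<forall>t. c + 2 *\<^sub>R p + t *\<^sub>R u \<in> L)"
      if "i \<in> I" for i
      using touching_cylinder_frame[of "Z i" c] assms(1) assms(2,4)[of i] that
      unfolding I_def by metis
    then show ?thesis by metis
  qed
  then obtain p u where op: "\<And>i. i \<in> I \<Longrightarrow> orthonormal_pair (p i) (u i)"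
    and axis: "\<And>i. i \<in> I \<Longrightarrow>
      \<exists>L. Z i = {x. infdist x L \<le> 1} \<and> (\<forall>t. c + 2 *\<^sub>R p i + t *\<^sub>R u i \<in> L)"
    by metis
  have "1 \<le> norm (p i + s *\<^sub>R u i - (p j + t *\<^sub>R u j))" if ij: "i \<in> I" "j \<in> I" "i \<noteq> j" for i j s t
  proof -
    \<comment> \<open>The parameters are doubled so that the difference of the two axis points is
      exactly twice the rescaled one.\<close>
    obtain L M where "Z i = {x. infdist x L \<le> 1}" "c + 2 *\<^sub>R p i + (2 * s) *\<^sub>R u i \<in> L"
      and "Z j = {x. infdist x M \<le> 1}" "c + 2 *\<^sub>R p j + (2 * t) *\<^sub>R u j \<in> M"
      using axis ij by meson
    then have "2 \<le> dist (c + 2 *\<^sub>R p i + (2 * s) *\<^sub>R u i) (c + 2 *\<^sub>R p j + (2 * t) *\<^sub>R u j)"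
      using assms(3)[of i j] ij dist_axes_ge_2[of L M] unfolding I_def by metis
    also have "\<dots> = norm (2 *\<^sub>R (p i + s *\<^sub>R u i - (p j + t *\<^sub>R u j)))"
      by (simp add: dist_norm algebra_simps)
    also have "\<dots> = 2 * norm (p i + s *\<^sub>R u i - (p j + t *\<^sub>R u j))"
      by (simp only: norm_scaleR)
    finally show ?thesis by simp
  qed
  then have "card I \<le> 6"
    by (intro card_separated_le_6[OF _ op]) (auto simp: I_def)
  then show ?thesis
    by (simp add: I_def)
qed

end
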